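(* Let $\mathbf X_1,\mathbf X_2,\ldots$ be independent observations from a continuous distribution function $F$ on $\mathbb{R}^d$. Let $D$ be an open bounded star-shaped set which belongs to $\mathcal{D}_d$. Suppose there exist scaling constants $s_n>0$, $s_n\to\infty$, such that the scaled sample clouds $N_n=\{\mathbf X_1/s_n,\ldots,\mathbf X_n/s_n\}$ converge onto the closure of $D$. If the bivariate projections $D_{ij}$, $1\le i<j\le d$, of the set $D$ are blunt, then $F$ is asymptotically independent.
   Context: A set $D\subset\mathbb{R}^d$ is star-shaped if $\mathbf x\in D$ implies $r\mathbf x\in D$ for $0<r<1$. For a non-empty bounded open star-shaped set $D$, let $D_\infty=\bigcup_{n>0} nD$ (an open cone), with gauge function $n_D(\mathbf x)=\inf\{t>0:\mathbf x\in tD\}$ on $D_\infty$. $\mathcal{D}_d$ is the class of all (non-empty) bounded open star-shaped sets $D\subset\mathbb{R}^d$ for which $D_\infty$ is convex, $n_D$ is continuous on $D_\infty$, and $D=\{\mathbf x\in D_\infty: n_D(\mathbf x)<1\}$. The sample cloud $N_n$ is viewed as a point process: $N_n(A)=\sum_{i=1}^n\mathbf 1_A(\mathbf X_i/s_n)$. Let $B$ be the open unit ball. Finite point processes $N_n$ converge onto a compact set $E\subset\mathbb{R}^d$ if $\mathbb{P}\{N_n(U^c)>0\}\to 0$ for every open set $U$ containing $E$, and $\mathbb{P}\{N_n(\mathbf p+\epsilon B)>m\}\to 1$ for all $m\ge 1$, $\epsilon>0$, $\mathbf p\in E$. $D_{ij}=\{(x_i,x_j):\mathbf x\in D\}\subset\mathbb{R}^2$.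 A bounded open star-shaped planar set $E$ is blunt if its coordinatewise supremum $(b_1,b_2)$, $b_k=\sup\{x_k:(x_1,x_2)\in E\}$, does not lie in the closure of $E$. Asymptotic independence: let $(X,Y)$ be a random vector with distribution function $F$ with continuous marginals $F_1,F_2$. Let $P$ be the function on $[0,1]^2$ determined by $P(F_1(x),F_2(y))=\mathbb{P}\{X>x,Y>y\}$; equivalently $P(u,v)=1+C(u,v)-u-v$ where $C$ is the copula of $F$. Then $X$ and $Y$ are asymptotically independent if $P(1-s,1-s)=o(s)$ as $s\downarrow 0$. A distribution function on $\mathbb{R}^d$ is asymptotically independent if every two components of a vector with this distribution are asymptotically independent. *)

theory Defs
  imports "HOL-Probability.Probability" "HOL-Library.Landau_Symbols"
begin

text \<open>
  The library's \<open>starlike\<close> requires a centre inside the set. Here the centre is the origin, and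
  it need not belong to the set.
\<close>
definition star_shaped :: "'a::real_vector set \<Rightarrow> bool" where
  "star_shaped D \<longleftrightarrow> (\<forall>x\<in>D. \<forall>r. 0 < r \<and> r < 1 \<longrightarrow> r *\<^sub>R x \<in> D)"

definition cone_of :: "'a::real_vector set \<Rightarrow> 'a set" where
  "cone_of D = (\<Union>n\<in>{1::nat..}. (\<lambda>x. real n *\<^sub>R x) ` D)"

definition gauge_fun :: "'a::real_vector set \<Rightarrow> 'a \<Rightarrow> real" where
  "gauge_fun D x = Inf {t. 0 < t \<and> x \<in> (\<lambda>y. t *\<^sub>R y) ` D}"

text \<open>The class $\mathcal{D}_d$, with $d$ the cardinality of the index type.\<close>
definition class_D :: "(real ^ 'n::finite) set set" where
  "class_D = {D. D \<noteq> {} \<and> bounded D \<and> open D \<and> star_shaped D \<and> convex (cone_of D) \<and>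
     continuous_on (cone_of D) (gauge_fun D) \<and> D = {x \<in> cone_of D. gauge_fun D x < 1}}"

definition bivariate_projection :: "'n \<Rightarrow> 'n \<Rightarrow> (real ^ 'n::finite) set \<Rightarrow> (real \<times> real) set" where
  "bivariate_projection i j D = (\<lambda>x. (x $ i, x $ j)) ` D"

text \<open>Only meant for non-empty bounded open star-shaped planar sets.\<close>
definition blunt :: "(real \<times> real) set \<Rightarrow> bool" where
  "blunt E \<longleftrightarrow> (Sup (fst ` E), Sup (snd ` E)) \<notin> closure E"

text \<open>Observations are numbered from 1; points are counted with multiplicity.\<close>
definition sample_cloud ::
  "(nat \<Rightarrow> 'a \<Rightarrow> real ^ 'n::finite) \<Rightarrow> (nat \<Rightarrow> real) \<Rightarrow> nat \<Rightarrow> 'a \<Rightarrow> (real ^ 'n) set \<Rightarrow> nat" where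
  "sample_cloud X s n \<omega> A = (\<Sum>i = 1..n. indicator A (X i \<omega> /\<^sub>R s n))"

definition converges_onto ::
  "'a measure \<Rightarrow> (nat \<Rightarrow> 'a \<Rightarrow> (real ^ 'n::finite) set \<Rightarrow> nat) \<Rightarrow> (real ^ 'n) set \<Rightarrow> bool" where
  "converges_onto M N E \<longleftrightarrow> compact E \<and>
     (\<forall>U. open U \<and> E \<subseteq> U \<longrightarrow>
        (\<lambda>n. measure M {\<omega> \<in> space M. N n \<omega> (- U) > 0}) \<longlonglongrightarrow> 0) \<and>
     (\<forall>m\<ge>1. \<forall>\<epsilon>>0. \<forall>p\<in>E.
        (\<lambda>n. measure M {\<omega> \<in> space M. N n \<omega> (ball p \<epsilon>) > m}) \<longlonglongrightarrow> 1)"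

text \<open>
  The order on vectors is componentwise, so \<open>{..x}\<close> below is a lower orthant.
\<close>
definition has_df :: "(real ^ 'n::finite) measure \<Rightarrow> (real ^ 'n \<Rightarrow> real) \<Rightarrow> bool" where
  "has_df \<mu> F \<longleftrightarrow> prob_space \<mu> \<and> sets \<mu> = sets borel \<and> (\<forall>x. F x = measure \<mu> {..x})"

text \<open>
  The function $P$ is determined by $P(F_1(x),F_2(y)) = \mathbb{P}\{X>x,Y>y\}$. As the marginals
  are continuous, their ranges contain $(0,1)$, so this equation fixes all the values
  $P(1-s,1-s)$ for $0<s<1$.
\<close>
definition asymp_indep_rv :: "'a measure \<Rightarrow> ('a \<Rightarrow> real) \<Rightarrow> ('a \<Rightarrow> real) \<Rightarrow> bool" where
  "asymp_indep_rv M X Y \<longleftrightarrow>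
     continuous_on UNIV (cdf (distr M borel X)) \<and> continuous_on UNIV (cdf (distr M borel Y)) \<and>
     (\<exists>P :: real \<Rightarrow> real \<Rightarrow> real.
        (\<forall>x y. P (cdf (distr M borel X) x) (cdf (distr M borel Y) y) =
                 measure M {\<omega> \<in> space M. X \<omega> > x \<and> Y \<omega> > y}) \<and>
        (\<lambda>s. P (1 - s) (1 - s)) \<in> o[at_right 0](\<lambda>s. s))"

definition asymp_indep_df :: "(real ^ 'n::finite \<Rightarrow> real) \<Rightarrow> bool" where
  "asymp_indep_df F \<longleftrightarrow>
     (\<forall>\<mu>. has_df \<mu> F \<longrightarrow>
        (\<forall>i j. i \<noteq> j \<longrightarrow> asymp_indep_rv \<mu> (\<lambda>x. x $ i) (\<lambda>x. x $ j)))"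

end

theory Submission
  imports Defs
begin

text \<open>
  Only the tail at the scale \<open>s n\<close> matters. Void probabilities of the cloud give
  \<open>n * \<mu> (s n * U\<^sup>c) \<longrightarrow> 0\<close> for \<open>U\<close> around \<open>closure D\<close>, while the
  sets \<open>{x. x $ i > (b i - \<epsilon>) * s n}\<close>, with \<open>b\<close> the coordinatewise
  supremum of \<open>D\<close>, have measure more than \<open>1 / (2 * n)\<close>. Hence the upper quantiles of level
  \<open>1 / (2 * n)\<close> of the components \<open>i\<close> and \<open>j\<close> exceed \<open>(b i - \<epsilon>) * s n\<close> and
  \<open>(b j - \<epsilon>) * s n\<close>. By bluntness the quadrant above \<open>(b i - \<epsilon>, b j - \<epsilon>)\<close> stays away from
  \<open>closure D\<close>, so a joint exceedance has probability \<open>o(1 / n)\<close>.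
\<close>

section \<open>Multivariate distribution functions: uniqueness of the law and continuity of the
  marginals\<close>

text \<open>Lower orthants are closed under intersection, generate the Borel sets and exhaust the
  space along the diagonal, so the pi-lambda argument applies.\<close>

lemma measure_eqI_atMost:
  fixes \<mu> \<nu> :: "'a::ordered_euclidean_space measure"
  assumes "prob_space \<mu>" "prob_space \<nu>"
    and sets: "sets \<mu> = sets borel" "sets \<nu> = sets borel"
    and eq: "\<And>x. measure \<mu> {..x} = measure \<nu> {..x}"
  shows "\<mu> = \<nu>"
proof (rule measure_eqI_generator_eq)
  interpret m: prob_space \<mu> by fact
  interpret n: prob_space \<nu> by fact
  let ?E = "range (\<lambda>x::'a. {..x})"
  show "Int_stable ?E"
  proof (rule Int_stableI)
    fix A B assume "A \<in> ?E" "B \<in> ?E"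
    then obtain a b where "A = {..a}" "B = {..b}" by auto
    then have "A \<inter> B = {..inf a b}" by auto
    then show "A \<inter> B \<in> ?E" by auto
  qed
  show "?E \<subseteq> Pow UNIV" by simp
  show "emeasure \<mu> A = emeasure \<nu> A" if "A \<in> ?E" for A
    using that eq by (auto simp: m.emeasure_eq_measure n.emeasure_eq_measure)
  show "sets \<mu> = sigma_sets UNIV ?E" "sets \<nu> = sigma_sets UNIV ?E"
    using sets by (simp_all add: borel_eq_atMost)
  show "range (\<lambda>k::nat. {..real k *\<^sub>R (One::'a)}) \<subseteq> ?E" by auto
  show "(\<Union>k::nat. {..real k *\<^sub>R (One::'a)}) = UNIV"
  proof (intro equalityI subsetI UNIV_I)
    fix x :: 'a
    obtain k where "Max ((\<bullet>) x ` Basis) \<le> real k"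
      using real_arch_simple by blast
    then have "x \<bullet> b \<le> real k" if "b \<in> Basis" for b
      using that by (auto simp: Max_le_iff)
    then have "x \<le> real k *\<^sub>R One"
      by (auto simp: eucl_le[where 'a='a])
    then show "x \<in> (\<Union>k::nat. {..real k *\<^sub>R (One::'a)})" by auto
  qed
  show "emeasure \<mu> {..real k *\<^sub>R (One::'a)} \<noteq> \<infinity>" for k
    by simp
qed

text \<open>\<open>asymp_indep_df\<close> quantifies over every law with distribution function
  \<open>F\<close>. Uniqueness identifies such a law with the law of each observation.\<close>

lemma has_df_unique:
  assumes "has_df \<mu> F" "has_df \<nu> F"
  shows "\<mu> = \<nu>"
  using assms unfolding has_df_def by (intro measure_eqI_atMost) metis+

text \<open>Continuity of \<open>F\<close> makes the face of \<open>{..x}\<close> in the hyperplane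
  where coordinate \<open>i\<close> equals \<open>x $ i\<close> a null set. Such a hyperplane is a
  countable union of such faces, so the marginal has no atoms, and its cdf is continuous.\<close>

lemma continuous_on_cdf_component:
  fixes F :: "real ^ 'n::finite \<Rightarrow> real"
  assumes df: "has_df \<mu> F" and F: "continuous_on UNIV F"
  shows "continuous_on UNIV (cdf (distr \<mu> borel (\<lambda>x. x $ i)))"
proof -
  interpret prob_space \<mu> using df by (simp add: has_df_def)
  have [measurable_cong, simp]: "sets \<mu> = sets borel" and Fx: "F x = measure \<mu> {..x}" for x
    using df by (auto simp: has_df_def)
  have sp[simp]: "space \<mu> = UNIV"
    using sets_eq_imp_space_eq[of \<mu> borel] by simp
  have null: "measure \<mu> {y \<in> {..x}. y $ i = x $ i} = 0" for x
  proof -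
    \<comment> \<open>The points \<open>?x k\<close> approach \<open>x\<close> from below along axis
      \<open>i\<close> only. The face lies in every difference \<open>{..x} - {..?x k}\<close>,
      whose measure tends to 0.\<close>
    let ?x = "\<lambda>k::nat. x - (1 / real (Suc k)) *\<^sub>R axis i 1"
    have "(\<lambda>k. F x - F (?x k)) \<longlonglongrightarrow> F x - F (x - 0 *\<^sub>R axis i 1)"
      using F by (intro tendsto_intros continuous_on_tendsto_compose[OF F]
          LIMSEQ_Suc[OF lim_1_over_n]) auto
    then have lim: "(\<lambda>k. F x - F (?x k)) \<longlonglongrightarrow> 0" by simp
    have "measure \<mu> {y \<in> {..x}. y $ i = x $ i} \<le> F x - F (?x k)" for k
    proof -
      have "?x k \<le> x" by (auto simp: less_eq_vec_def axis_def)
      have "measure \<mu> {y \<in> {..x}. y $ i = x $ i} \<le> measure \<mu> ({..x} - {..?x k})"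
      proof (intro finite_measure_mono subsetI)
        fix y assume y: "y \<in> {y \<in> {..x}. y $ i = x $ i}"
        then have "\<not> y $ i \<le> ?x k $ i" by simp
        then have "\<not> y \<le> ?x k" unfolding less_eq_vec_def by blast
        with y show "y \<in> {..x} - {..?x k}" by simp
      qed simp
      also have "\<dots> = F x - F (?x k)"
        unfolding Fx using \<open>?x k \<le> x\<close> by (intro finite_measure_Diff) (auto intro: order_trans)
      finally show ?thesis .
    qed
    then have "measure \<mu> {y \<in> {..x}. y $ i = x $ i} \<le> 0"
      by (intro LIMSEQ_le_const[OF lim]) auto
    then show ?thesis by (simp add: measure_le_0_iff)
  qed
  interpret C: prob_space "distr \<mu> borel (\<lambda>x. x $ i)"
    by (intro prob_space_distr) measurable
  interpret C: finite_borel_measure "distr \<mu> borel (\<lambda>x. x $ i)"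
    by standard auto
  have "measure (distr \<mu> borel (\<lambda>x. x $ i)) {t} = 0" for t
  proof -
    \<comment> \<open>Coordinate \<open>i\<close> stays at \<open>t\<close> while all others grow
      with \<open>k\<close>, so the faces exhaust the hyperplane.\<close>
    let ?b = "\<lambda>k::nat. (\<chi> j. if j = i then t else real k) :: real ^ 'n"
    have un: "{y. y $ i = t} = (\<Union>k. {y \<in> {..?b k}. y $ i = ?b k $ i})"
    proof (intro equalityI subsetI)
      fix y :: "real ^ 'n" assume "y \<in> {y. y $ i = t}"
      moreover obtain k where "Max (range (($) y)) \<le> real k"
        using real_arch_simple by blast
      ultimately show "y \<in> (\<Union>k. {y \<in> {..?b k}. y $ i = ?b k $ i})"
        by (auto simp: less_eq_vec_def)
    qed auto
    have "emeasure \<mu> {y \<in> {..?b k}. y $ i = ?b k $ i} = 0" for k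
      unfolding emeasure_eq_measure null by simp
    then have "emeasure \<mu> (\<Union>k. {y \<in> {..?b k}. y $ i = ?b k $ i}) = 0"
      by (intro emeasure_UN_eq_0) auto
    then have "measure \<mu> {y. y $ i = t} = 0"
      by (simp add: un emeasure_eq_measure)
    then show ?thesis
      by (subst measure_distr) (auto simp: vimage_def)
  qed
  then show ?thesis
    by (simp add: continuous_on_eq_continuous_at C.isCont_cdf)
qed

section \<open>A criterion for asymptotic independence in terms of thresholds\<close>

text \<open>The work is to produce \<open>P\<close>. Joint exceedance probabilities depend on the
  thresholds only through the marginal cdf values, so \<open>P\<close> can be defined by choosing
  thresholds. Continuity makes every level \<open>1 - s\<close> with \<open>0 < s < 1\<close>
  attained, hence \<open>small\<close> controls \<open>P (1 - s) (1 - s)\<close>.\<close>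

lemma asymp_indep_rvI:
  assumes "prob_space M" and [measurable]: "X \<in> borel_measurable M" "Y \<in> borel_measurable M"
    and cont: "continuous_on UNIV (cdf (distr M borel X))" "continuous_on UNIV (cdf (distr M borel Y))"
    and small: "\<And>c. c > 0 \<Longrightarrow> \<forall>\<^sub>F s in at_right 0. \<forall>x y.
      measure M {\<omega> \<in> space M. X \<omega> > x} = s \<longrightarrow> measure M {\<omega> \<in> space M. Y \<omega> > y} = s \<longrightarrow>
      measure M {\<omega> \<in> space M. X \<omega> > x \<and> Y \<omega> > y} \<le> c * s"
  shows "asymp_indep_rv M X Y"
proof -
  interpret prob_space M by fact
  have cdf: "cdf (distr M borel Z) x = 1 - prob {\<omega> \<in> space M. Z \<omega> > x}"
    if [measurable]: "Z \<in> borel_measurable M" for Z x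
  proof -
    have "cdf (distr M borel Z) x = prob (space M - {\<omega> \<in> space M. Z \<omega> > x})"
      by (auto simp: cdf_def measure_distr intro!: arg_cong[of _ _ prob])
    then show ?thesis by (subst (asm) prob_compl) auto
  qed
  have sub: "prob {\<omega> \<in> space M. Z \<omega> > x \<and> \<omega> \<in> A} = prob {\<omega> \<in> space M. Z \<omega> > y \<and> \<omega> \<in> A}"
    if [measurable]: "Z \<in> borel_measurable M" "A \<in> events"
      and eq: "cdf (distr M borel Z) x = cdf (distr M borel Z) y" and "x \<le> y" for Z A x y
  proof (rule measure_eq_AE)
    \<comment> \<open>Equal cdf values leave no mass for \<open>Z\<close> between the two
      thresholds, so the two events differ by a null set.\<close>
    have "prob ({\<omega> \<in> space M. Z \<omega> > x} - {\<omega> \<in> space M. Z \<omega> > y}) = 0"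
      using eq \<open>x \<le> y\<close> by (subst finite_measure_Diff) (auto simp: cdf)
    then have "AE \<omega> in M. \<omega> \<notin> {\<omega> \<in> space M. Z \<omega> > x} - {\<omega> \<in> space M. Z \<omega> > y}"
      by (intro AE_not_in) (auto simp: null_sets_def emeasure_eq_measure)
    then show "AE \<omega> in M. \<omega> \<in> {\<omega> \<in> space M. Z \<omega> > x \<and> \<omega> \<in> A} \<longleftrightarrow> \<omega> \<in> {\<omega> \<in> space M. Z \<omega> > y \<and> \<omega> \<in> A}"
      using \<open>x \<le> y\<close> by (auto elim!: eventually_mono)
  qed auto
  have indep: "prob {\<omega> \<in> space M. Z \<omega> > x \<and> \<omega> \<in> A} = prob {\<omega> \<in> space M. Z \<omega> > y \<and> \<omega> \<in> A}"
    if "Z \<in> borel_measurable M" "A \<in> events"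
      and "cdf (distr M borel Z) x = cdf (distr M borel Z) y" for Z A x y
    using sub[OF that] sub[OF that(1,2) that(3)[symmetric]] by (metis linear)
  \<comment> \<open>An arbitrary preimage of \<open>u\<close> under the cdf, unspecified when
    \<open>u\<close> is outside its range.\<close>
  define q where "q Z u = (SOME x. cdf (distr M borel Z) x = u)" for Z u
  have q: "cdf (distr M borel Z) (q Z (cdf (distr M borel Z) x)) = cdf (distr M borel Z) x" for Z x
    unfolding q_def by (rule someI) simp
  have range: "\<exists>x. cdf (distr M borel Z) x = 1 - s"
    if [measurable]: "Z \<in> borel_measurable M" and cZ: "continuous_on UNIV (cdf (distr M borel Z))"
      and s: "0 < s" "s < 1" for Z s
  proof -
    interpret Z: real_distribution "distr M borel Z" by (simp add: real_distribution_distr)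
    obtain a where a: "cdf (distr M borel Z) a < 1 - s"
      using order_tendstoD(2)[OF Z.cdf_lim_at_bot, of "1 - s"] s
      by (auto simp: eventually_at_bot_linorder)
    obtain b where b: "cdf (distr M borel Z) b > 1 - s"
      using order_tendstoD(1)[OF Z.cdf_lim_at_top_prob, of "1 - s"] s
      by (auto simp: eventually_at_top_linorder)
    have "a \<le> b"
      using a b Z.cdf_nondecreasing[of b a] by linarith
    then show ?thesis
      using IVT'[of "cdf (distr M borel Z)" a "1 - s" b] a b continuous_on_subset[OF cZ] by auto
  qed
  define P where "P u v = prob {\<omega> \<in> space M. X \<omega> > q X u \<and> Y \<omega> > q Y v}" for u v
  have P: "P (cdf (distr M borel X) x) (cdf (distr M borel Y) y) = prob {\<omega> \<in> space M. X \<omega> > x \<and> Y \<omega> > y}"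
    for x y
  proof -
    let ?x = "q X (cdf (distr M borel X) x)" and ?y = "q Y (cdf (distr M borel Y) y)"
    \<comment> \<open>The thresholds are exchanged one at a time: first that of \<open>X\<close>
      with the event for \<open>Y\<close> fixed, then that of \<open>Y\<close>.\<close>
    have "prob {\<omega> \<in> space M. X \<omega> > ?x \<and> \<omega> \<in> {\<omega> \<in> space M. Y \<omega> > ?y}} =
        prob {\<omega> \<in> space M. X \<omega> > x \<and> \<omega> \<in> {\<omega> \<in> space M. Y \<omega> > ?y}}"
      by (intro indep q) auto
    moreover have "prob {\<omega> \<in> space M. Y \<omega> > ?y \<and> \<omega> \<in> {\<omega> \<in> space M. X \<omega> > x}} =
        prob {\<omega> \<in> space M. Y \<omega> > y \<and> \<omega> \<in> {\<omega> \<in> space M. X \<omega> > x}}"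
      by (intro indep q) auto
    ultimately show ?thesis by (simp add: P_def conj_commute cong: conj_cong)
  qed
  have "(\<lambda>s. P (1 - s) (1 - s)) \<in> o[at_right 0](\<lambda>s. s)"
  proof (rule landau_o.smallI)
    fix c :: real assume "c > 0"
    have "\<forall>\<^sub>F s::real in at_right 0. 0 < s \<and> s < 1"
      by (auto simp: eventually_at_right_field intro!: exI[of _ 1])
    with small[OF \<open>c > 0\<close>] show "\<forall>\<^sub>F s in at_right 0. norm (P (1 - s) (1 - s)) \<le> c * norm s"
    proof eventually_elim
      case (elim s)
      obtain x y where "cdf (distr M borel X) x = 1 - s" "cdf (distr M borel Y) y = 1 - s"
        using range cont elim assms(2,3) by metis
      with elim P[of x y] show ?case by (auto simp: cdf)
    qed
  qed
  with P cont show ?thesis unfolding asymp_indep_rv_def by blast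
qed

section \<open>Hitting probabilities of the scaled sample cloud\<close>

lemma sample_cloud_hit_iff:
  "sample_cloud X s n \<omega> A > 0 \<longleftrightarrow> (\<exists>i\<in>{1..n}. X i \<omega> /\<^sub>R s n \<in> A)"
proof -
  have "sample_cloud X s n \<omega> A = 0 \<longleftrightarrow> (\<forall>i\<in>{1..n}. X i \<omega> /\<^sub>R s n \<notin> A)"
    unfolding sample_cloud_def by (subst sum_eq_0_iff) (auto simp: indicator_def)
  then show ?thesis by (metis gr0I less_numeral_extra(3))
qed

lemma scaled_in_borel:
  fixes A :: "'a::real_normed_vector set"
  assumes "A \<in> sets borel"
  shows "{x. x /\<^sub>R c \<in> A} \<in> sets borel"
proof -
  have "(\<lambda>x::'a. x /\<^sub>R c) \<in> borel_measurable borel"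
    by (intro borel_measurable_continuous_onI continuous_intros)
  from measurable_sets_borel[OF this assms] show ?thesis by (simp add: vimage_def)
qed

lemma sample_cloud_hit_measurable:
  assumes "\<And>i. i \<in> {1..n} \<Longrightarrow> X i \<in> borel_measurable M" and "A \<in> sets borel"
  shows "{\<omega> \<in> space M. sample_cloud X s n \<omega> A > 0} \<in> sets M"
proof -
  have "{\<omega> \<in> space M. sample_cloud X s n \<omega> A > 0} =
      (\<Union>i\<in>{1..n}. X i -` {x. x /\<^sub>R s n \<in> A} \<inter> space M)"
    by (auto simp: sample_cloud_hit_iff)
  then show ?thesis
    using assms by (auto intro!: measurable_sets scaled_in_borel)
qed

text \<open>The cloud misses \<open>A\<close> exactly when all \<open>n\<close> independent
  observations, each of law \<open>\<mu>\<close>, avoid the rescaled set, so the missing probability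
  is an \<open>n\<close>-th power.\<close>

lemma indep_vars_prob_hits:
  fixes X :: "nat \<Rightarrow> 'a \<Rightarrow> real ^ 'n::finite"
  assumes "prob_space M" and indep: "prob_space.indep_vars M (\<lambda>_. borel) X {1..}"
    and df: "\<And>i. i \<ge> 1 \<Longrightarrow> distr M borel (X i) = \<mu>"
    and A: "A \<in> sets borel" and "n \<ge> 1"
  shows "measure M {\<omega> \<in> space M. sample_cloud X s n \<omega> A > 0} =
    1 - (1 - measure \<mu> {x. x /\<^sub>R s n \<in> A}) ^ n"
proof -
  interpret prob_space M by fact
  let ?B = "{x. x /\<^sub>R s n \<in> A}"
  have X[measurable]: "X i \<in> borel_measurable M" if "i \<ge> 1" for i
    using indep that by (auto simp: indep_vars_def)
  have B: "?B \<in> sets borel" using A by (rule scaled_in_borel)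
  have "\<mu> = distr M borel (X 1)" using df by simp
  then interpret \<mu>: prob_space \<mu> using X[of 1] by (simp add: prob_space_distr)
  have \<mu>: "sets \<mu> = sets borel" "space \<mu> = UNIV"
    using \<open>\<mu> = _\<close> by auto
  have "space M - {\<omega> \<in> space M. sample_cloud X s n \<omega> A > 0} = (\<Inter>i\<in>{1..n}. X i -` (- ?B) \<inter> space M)"
    using \<open>n \<ge> 1\<close> by (auto simp: sample_cloud_hit_iff)
  moreover have "prob (\<Inter>i\<in>{1..n}. X i -` (- ?B) \<inter> space M) = (\<Prod>i\<in>{1..n}. prob (X i -` (- ?B) \<inter> space M))"
    using \<open>n \<ge> 1\<close> B by (intro indep_varsD[OF indep]) auto
  moreover have "prob (X i -` (- ?B) \<inter> space M) = 1 - measure \<mu> ?B" if "i \<in> {1..n}" for i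
  proof -
    have "prob (X i -` (- ?B) \<inter> space M) = measure \<mu> (- ?B)"
      using B X df[of i, symmetric] that by (simp add: measure_distr)
    also have "\<dots> = 1 - measure \<mu> ?B"
      using \<mu>.prob_compl[of ?B] B \<mu> by (simp add: Compl_eq_Diff_UNIV)
    finally show ?thesis .
  qed
  ultimately have "prob (space M - {\<omega> \<in> space M. sample_cloud X s n \<omega> A > 0}) = (1 - measure \<mu> ?B) ^ n"
    by simp
  moreover have "{\<omega> \<in> space M. sample_cloud X s n \<omega> A > 0} \<in> events"
    using A X by (intro sample_cloud_hit_measurable) auto
  ultimately show ?thesis by (simp add: prob_compl)
qed

text \<open>Since \<open>(1 - p n) ^ n \<le> exp (- (real n * p n))\<close>, a hitting probability
  below \<open>1 - exp (- c)\<close> forces \<open>real n * p n < c\<close>.\<close>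

lemma eventually_mult_less_if_hit_prob_tendsto_0:
  fixes p :: "nat \<Rightarrow> real"
  assumes lim: "(\<lambda>n. 1 - (1 - p n) ^ n) \<longlonglongrightarrow> 0" and p: "\<And>n. p n \<le> 1" and "c > 0"
  shows "\<forall>\<^sub>F n in sequentially. real n * p n < c"
proof -
  have "\<forall>\<^sub>F n in sequentially. 1 - (1 - p n) ^ n < 1 - exp (- c)"
    using \<open>c > 0\<close> by (intro order_tendstoD(2)[OF lim]) simp
  then show ?thesis
  proof eventually_elim
    case (elim n)
    have "(1 - p n) ^ n \<le> exp (- p n) ^ n"
      using p[of n] exp_ge_add_one_self[of "- p n"] by (intro power_mono) auto
    also have "\<dots> = exp (- (real n * p n))"
      by (simp add: exp_of_nat_mult[symmetric])
    finally have "exp (- c) < exp (- (real n * p n))" using elim by linarith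
    then show ?case by simp
  qed
qed

text \<open>Bernoulli's inequality bounds the hitting probability above by
  \<open>real n * p n\<close>. Any constant below 1 could replace \<open>1 / 2\<close>.\<close>

lemma eventually_mult_greater_half_if_hit_prob_tendsto_1:
  fixes p :: "nat \<Rightarrow> real"
  assumes lim: "(\<lambda>n. 1 - (1 - p n) ^ n) \<longlonglongrightarrow> 1" and p: "\<And>n. p n \<le> 1"
  shows "\<forall>\<^sub>F n in sequentially. real n * p n > 1 / 2"
proof -
  have "\<forall>\<^sub>F n in sequentially. 1 - (1 - p n) ^ n > 1 / 2"
    by (intro order_tendstoD(1)[OF lim]) simp
  then show ?thesis
  proof eventually_elim
    case (elim n)
    have "1 + real n * (- p n) \<le> (1 + (- p n)) ^ n"
      using p[of n] by (intro Bernoulli_inequality) simp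
    with elim show ?case by simp
  qed
qed

section \<open>Geometry of bluntness\<close>

text \<open>Points of \<open>closure D\<close> never exceed the coordinatewise supremum, so a point
  with both coordinates nearly maximal would project close to the supremum point, which has positive
  distance from the closure of the projection.\<close>

lemma blunt_quadrant_disjoint_closure:
  fixes D :: "(real ^ 'n::finite) set"
  assumes "bounded D" and "blunt (bivariate_projection i j D)"
  obtains \<epsilon> where "\<epsilon> > 0"
    "closure D \<inter> {x. x $ i \<ge> (SUP x\<in>D. x $ i) - \<epsilon> \<and> x $ j \<ge> (SUP x\<in>D. x $ j) - \<epsilon>} = {}"
proof -
  define b where "b k = (SUP x\<in>D. x $ k)" for k
  let ?E = "bivariate_projection i j D"
  have bdd: "bdd_above ((\<lambda>x. x $ k) ` D)" for k
    using \<open>bounded D\<close> by (intro bounded_imp_bdd_above bounded_component_cart)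
  have "D \<subseteq> {x. x $ k \<le> b k}" for k
    using bdd by (auto simp: b_def intro: cSUP_upper)
  then have le: "closure D \<subseteq> {x. x $ k \<le> b k}" for k
    by (intro closure_minimal closed_Collect_le continuous_intros)
  have "(b i, b j) \<notin> closure ?E"
    using assms(2) by (simp add: blunt_def bivariate_projection_def b_def image_image)
  then obtain \<delta> where "\<delta> > 0" and \<delta>: "ball (b i, b j) \<delta> \<subseteq> - closure ?E"
    using openE[of "- closure ?E" "(b i, b j)"] by auto
  show ?thesis
  \<comment> \<open>The two coordinate gaps add up to at most \<open>2 * \<delta> / 3\<close>, which
    is strictly below \<open>\<delta>\<close>.\<close>
  proof (rule that[of "\<delta> / 3"])
    show "closure D \<inter> {x. x $ i \<ge> (SUP x\<in>D. x $ i) - \<delta> / 3 \<and> x $ j \<ge> (SUP x\<in>D. x $ j) - \<delta> / 3} = {}"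
    proof (intro equals0I)
      fix x assume "x \<in> closure D \<inter> {x. x $ i \<ge> (SUP x\<in>D. x $ i) - \<delta> / 3 \<and> x $ j \<ge> (SUP x\<in>D. x $ j) - \<delta> / 3}"
      then have x: "x \<in> closure D" "x $ i \<ge> b i - \<delta> / 3" "x $ j \<ge> b j - \<delta> / 3"
        by (auto simp: b_def)
      have "(\<lambda>x. (x $ i, x $ j)) ` closure D \<subseteq> closure ?E"
        by (intro image_closure_subset continuous_intros)
          (auto simp: bivariate_projection_def intro: subsetD[OF closure_subset])
      then have "(x $ i, x $ j) \<in> closure ?E" using x by auto
      moreover have "dist (b i, b j) (x $ i, x $ j) \<le> dist (b i) (x $ i) + dist (b j) (x $ j)"
        by (simp add: dist_Pair_Pair sqrt_sum_squares_le_sum)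
      then have "dist (b i, b j) (x $ i, x $ j) < \<delta>"
        using x subsetD[OF le x(1), of i] subsetD[OF le x(1), of j] \<open>\<delta> > 0\<close>
        by (auto simp: dist_real_def)
      then have "(x $ i, x $ j) \<notin> closure ?E" using \<delta> by (auto simp: subset_iff)
      ultimately show False by blast
    qed
  qed (use \<open>\<delta> > 0\<close> in simp)
qed

section \<open>From sample sizes to a continuous level\<close>

text \<open>Carries estimates along the sample sizes \<open>n\<close> over to all small levels
  \<open>s\<close>. The integer part \<open>n\<close> of \<open>1 / (2 * s)\<close> satisfies
  \<open>n \<le> 1 / (2 * s) < n + 1 \<le> 2 * n\<close>, so \<open>s\<close> and
  \<open>1 / (2 * n)\<close> agree up to a factor 2.\<close>

lemma eventually_at_right_0_nat_floor_inverse: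
  assumes "\<forall>\<^sub>F n in sequentially. Q n"
  shows "\<forall>\<^sub>F s::real in at_right 0. \<exists>n\<ge>1. Q n \<and> s \<le> 1 / (2 * real n) \<and> 1 / real n \<le> 4 * s"
proof -
  obtain m where m: "\<And>n. n \<ge> m \<Longrightarrow> Q n"
    using assms by (auto simp: eventually_sequentially)
  have "\<exists>n\<ge>1. Q n \<and> s \<le> 1 / (2 * real n) \<and> 1 / real n \<le> 4 * s"
    \<comment> \<open>This bound gives \<open>n \<ge> m + 1\<close>, which ensures both
      \<open>n \<ge> 1\<close> and \<open>Q n\<close>.\<close>
    if s: "0 < s" "s < 1 / (2 * (real m + 1))" for s
  proof -
    define n where "n = nat \<lfloor>1 / (2 * s)\<rfloor>"
    have "real m + 1 < 1 / (2 * s)" using s by (simp add: field_simps)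
    then have n: "n \<ge> m + 1" "real n \<le> 1 / (2 * s)" "1 / (2 * s) < real n + 1"
      unfolding n_def by linarith+
    have "1 / (2 * s) < 2 * real n" using n by linarith
    then have "1 / real n \<le> 4 * s" using s n by (simp add: field_simps)
    moreover have "s \<le> 1 / (2 * real n)" using s n by (simp add: field_simps)
    moreover have "n \<ge> 1" "Q n" using n m by auto
    ultimately show ?thesis by blast
  qed
  then show ?thesis
    by (auto simp: eventually_at_right_field intro!: exI[of _ "1 / (2 * (real m + 1))"])
qed

section \<open>Tail estimates from the convergence of the clouds, and their combination\<close>

theorem theorem4p3:
  fixes M :: "'a measure"
    and X :: "nat \<Rightarrow> 'a \<Rightarrow> real ^ 'n::finite"
    and F :: "real ^ 'n \<Rightarrow> real"
    and D :: "(real ^ 'n) set"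
    and s :: "nat \<Rightarrow> real"
  assumes "prob_space M"
    and "prob_space.indep_vars M (\<lambda>_. borel) X {1..}"
    and "\<And>i. i \<ge> 1 \<Longrightarrow> has_df (distr M borel (X i)) F"
    and "continuous_on UNIV F"
    and "D \<in> class_D"
    and "\<And>n. n \<ge> 1 \<Longrightarrow> s n > 0"
    and "filterlim s at_top sequentially"
    and "converges_onto M (sample_cloud X s) (closure D)"
    and "\<And>i j. i \<noteq> j \<Longrightarrow> blunt (bivariate_projection i j D)"
  shows "asymp_indep_df F"
  unfolding asymp_indep_df_def
proof (intro allI impI)
  fix \<mu> and i j :: 'n
  assume df: "has_df \<mu> F" and "i \<noteq> j"
  interpret M: prob_space M by fact
  interpret \<mu>: prob_space \<mu> using df by (simp add: has_df_def)
  have sets[measurable_cong, simp]: "sets \<mu> = sets borel"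
    using df by (simp add: has_df_def)
  have [simp]: "space \<mu> = UNIV"
    using sets_eq_imp_space_eq[OF sets] by simp
  have D: "bounded D" "D \<noteq> {}"
    using assms(5) by (auto simp: class_D_def)
  define p where "p A n = measure \<mu> {x. x /\<^sub>R s n \<in> A}" for A n
  have p_le_1: "p A n \<le> 1" for A n
    by (simp add: p_def)
  have hits: "\<forall>\<^sub>F n in sequentially.
      measure M {\<omega> \<in> space M. sample_cloud X s n \<omega> A > 0} = 1 - (1 - p A n) ^ n"
    if "A \<in> sets borel" for A
    unfolding p_def using eventually_ge_at_top[of 1]
    by eventually_elim
      (use indep_vars_prob_hits[OF assms(1,2) has_df_unique[OF assms(3) df] that] in simp)
  have outside: "\<forall>\<^sub>F n in sequentially. real n * p A n < c"
    if "closed A" "closure D \<inter> A = {}" "c > 0" for A c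
  proof (rule eventually_mult_less_if_hit_prob_tendsto_0)
    \<comment> \<open>The open neighbourhood of \<open>closure D\<close> is \<open>- A\<close>; the
      double complement matches the form in \<open>converges_onto_def\<close>.\<close>
    have "(\<lambda>n. measure M {\<omega> \<in> space M. sample_cloud X s n \<omega> (- (- A)) > 0}) \<longlonglongrightarrow> 0"
      using assms(8) that unfolding converges_onto_def by (blast intro: open_Compl)
    then show "(\<lambda>n. 1 - (1 - p A n) ^ n) \<longlonglongrightarrow> 0"
      using hits[of A] that by (simp add: tendsto_cong borel_closed)
  qed (use p_le_1 that in auto)
  have inside: "\<forall>\<^sub>F n in sequentially. real n * p (ball x \<epsilon>) n > 1 / 2"
    if "x \<in> closure D" "\<epsilon> > 0" for x \<epsilon>
  proof (rule eventually_mult_greater_half_if_hit_prob_tendsto_1)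
    let ?N = "\<lambda>n \<omega>. sample_cloud X s n \<omega> (ball x \<epsilon>)"
    \<comment> \<open>The least admissible \<open>m = 1\<close> already yields two points in the
      ball; a single one is enough for a hit.\<close>
    have lim: "(\<lambda>n. measure M {\<omega> \<in> space M. ?N n \<omega> > 1}) \<longlonglongrightarrow> 1"
      using assms(8) that unfolding converges_onto_def by blast
    have ev: "{\<omega> \<in> space M. ?N n \<omega> > 0} \<in> sets M" for n
      using assms(2) by (intro sample_cloud_hit_measurable) (auto simp: M.indep_vars_def)
    have "(\<lambda>n. measure M {\<omega> \<in> space M. ?N n \<omega> > 0}) \<longlonglongrightarrow> 1"
      by (rule tendsto_sandwich[OF _ _ lim tendsto_const])
        (auto intro!: always_eventually M.finite_measure_mono ev)
    then show "(\<lambda>n. 1 - (1 - p (ball x \<epsilon>) n) ^ n) \<longlonglongrightarrow> 1"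
      using hits[of "ball x \<epsilon>"] by (simp add: tendsto_cong)
  qed (rule p_le_1)
  define b where "b k = (SUP x\<in>D. x $ k)" for k
  have high: "\<forall>\<^sub>F n in sequentially. measure \<mu> {x. x $ k > (b k - \<epsilon>) * s n} > 1 / (2 * real n)"
    if "\<epsilon> > 0" for k \<epsilon>
  proof -
    \<comment> \<open>Half of \<open>\<epsilon>\<close> is spent on choosing \<open>x\<close> in
      \<open>D\<close> near the supremum, the other half on the radius of a ball around
      \<open>x\<close>; the ball then lies above level \<open>b k - \<epsilon>\<close>.\<close>
    have "b k - \<epsilon> / 2 < b k" using that by simp
    then obtain x where x: "x \<in> D" "b k - \<epsilon> / 2 < x $ k"
      unfolding b_def using D by (subst (asm) less_cSUP_iff)
        (auto intro: bounded_imp_bdd_above bounded_component_cart)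
    then have "\<forall>\<^sub>F n in sequentially. real n * p (ball x (\<epsilon> / 2)) n > 1 / 2"
      using that by (intro inside) (auto intro: subsetD[OF closure_subset])
    then show ?thesis
      using eventually_ge_at_top[of 1]
    proof eventually_elim
      case (elim n)
      have "(b k - \<epsilon>) * s n < y $ k" if "y /\<^sub>R s n \<in> ball x (\<epsilon> / 2)" for y
      proof -
        have "\<bar>(x - y /\<^sub>R s n) $ k\<bar> < \<epsilon> / 2"
          using that component_le_norm_cart[of "x - y /\<^sub>R s n" k] by (simp add: dist_norm)
        moreover have "(x - y /\<^sub>R s n) $ k = x $ k - y $ k / s n"
          by (simp add: divide_inverse)
        ultimately have "b k - \<epsilon> < y $ k / s n" using x by linarith
        then show ?thesis using assms(6)[of n] elim by (simp add: field_simps)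
      qed
      then have "{y. y /\<^sub>R s n \<in> ball x (\<epsilon> / 2)} \<subseteq> {y. y $ k > (b k - \<epsilon>) * s n}"
        by blast
      moreover have "{y. y $ k > (b k - \<epsilon>) * s n} \<in> sets \<mu>"
        by simp
      ultimately have "p (ball x (\<epsilon> / 2)) n \<le> measure \<mu> {x. x $ k > (b k - \<epsilon>) * s n}"
        unfolding p_def by (rule \<mu>.finite_measure_mono)
      then have "1 / 2 < real n * measure \<mu> {x. x $ k > (b k - \<epsilon>) * s n}"
        using elim by (smt (verit) mult_left_mono of_nat_0_le_iff)
      then show ?case using elim by (simp add: field_simps)
    qed
  qed
  obtain \<epsilon> where "\<epsilon> > 0" and \<epsilon>: "closure D \<inter> {x. x $ i \<ge> b i - \<epsilon> \<and> x $ j \<ge> b j - \<epsilon>} = {}"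
    unfolding b_def using blunt_quadrant_disjoint_closure[OF D(1) assms(9)[OF \<open>i \<noteq> j\<close>]] by blast
  define K where "K = {x. x $ i \<ge> b i - \<epsilon> \<and> x $ j \<ge> b j - \<epsilon>}"
  have K: "closed K" "closure D \<inter> K = {}"
    using \<epsilon> unfolding K_def by (auto intro!: closed_Collect_conj closed_Collect_le continuous_intros)
  show "asymp_indep_rv \<mu> (\<lambda>x. x $ i) (\<lambda>x. x $ j)"
  proof (rule asymp_indep_rvI)
    fix c :: real assume "c > 0"
    \<comment> \<open>The constant \<open>c / 4\<close> absorbs the factor 4 in
      \<open>1 / real n \<le> 4 * t\<close>.\<close>
    have "\<forall>\<^sub>F n in sequentially. real n * p K n < c / 4 \<and>
        measure \<mu> {x. x $ i > (b i - \<epsilon>) * s n} > 1 / (2 * real n) \<and>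
        measure \<mu> {x. x $ j > (b j - \<epsilon>) * s n} > 1 / (2 * real n)"
      using outside[OF K, of "c / 4"] high[OF \<open>\<epsilon> > 0\<close>] \<open>c > 0\<close> by (intro eventually_conj) auto
    from eventually_at_right_0_nat_floor_inverse[OF this]
    show "\<forall>\<^sub>F t in at_right 0. \<forall>x y. measure \<mu> {\<omega> \<in> space \<mu>. x < \<omega> $ i} = t \<longrightarrow>
        measure \<mu> {\<omega> \<in> space \<mu>. y < \<omega> $ j} = t \<longrightarrow>
        measure \<mu> {\<omega> \<in> space \<mu>. x < \<omega> $ i \<and> y < \<omega> $ j} \<le> c * t"
    proof (eventually_elim, intro allI impI)
      fix t x y
      assume ex: "\<exists>n\<ge>1. (real n * p K n < c / 4 \<and>
          measure \<mu> {x. x $ i > (b i - \<epsilon>) * s n} > 1 / (2 * real n) \<and>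
          measure \<mu> {x. x $ j > (b j - \<epsilon>) * s n} > 1 / (2 * real n)) \<and>
          t \<le> 1 / (2 * real n) \<and> 1 / real n \<le> 4 * t"
        and x: "measure \<mu> {\<omega> \<in> space \<mu>. x < \<omega> $ i} = t"
        and y: "measure \<mu> {\<omega> \<in> space \<mu>. y < \<omega> $ j} = t"
      from ex obtain n where n: "n \<ge> 1" "real n * p K n < c / 4"
        and q: "measure \<mu> {x. x $ i > (b i - \<epsilon>) * s n} > t" "measure \<mu> {x. x $ j > (b j - \<epsilon>) * s n} > t"
        and t: "1 / real n \<le> 4 * t"
        by auto
      \<comment> \<open>Tails decrease in the threshold, so a tail strictly larger than
        \<open>t\<close> at \<open>a\<close> places \<open>a\<close> at or below any threshold whose
        tail equals \<open>t\<close>.\<close>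
      have quantile: "a \<le> z" if "measure \<mu> {\<omega> \<in> space \<mu>. z < \<omega> $ k} = t" "measure \<mu> {\<omega>. \<omega> $ k > a} > t" for a z k
      proof (rule ccontr)
        assume "\<not> a \<le> z"
        then have "measure \<mu> {\<omega>. \<omega> $ k > a} \<le> measure \<mu> {\<omega> \<in> space \<mu>. z < \<omega> $ k}"
          by (intro \<mu>.finite_measure_mono) auto
        with that show False by simp
      qed
      have "(b i - \<epsilon>) * s n \<le> x" "(b j - \<epsilon>) * s n \<le> y"
        using quantile[OF x q(1)] quantile[OF y q(2)] by auto
      \<comment> \<open>Dividing by \<open>s n > 0\<close> puts every joint exceedance into the
        quadrant \<open>K\<close>, which is disjoint from \<open>closure D\<close>.\<close>
      then have "{\<omega> \<in> space \<mu>. x < \<omega> $ i \<and> y < \<omega> $ j} \<subseteq> {\<omega>. \<omega> /\<^sub>R s n \<in> K}"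
        using assms(6)[OF n(1)] by (auto simp: K_def field_simps)
      moreover have "{\<omega>. \<omega> /\<^sub>R s n \<in> K} \<in> sets \<mu>"
        unfolding K_def by simp
      ultimately have "measure \<mu> {\<omega> \<in> space \<mu>. x < \<omega> $ i \<and> y < \<omega> $ j} \<le> p K n"
        unfolding p_def by (intro \<mu>.finite_measure_mono)
      also have "\<dots> \<le> c / 4 * (1 / real n)" using n by (simp add: field_simps)
      also have "\<dots> \<le> c / 4 * (4 * t)" using t \<open>c > 0\<close> by (intro mult_left_mono) auto
      finally show "measure \<mu> {\<omega> \<in> space \<mu>. x < \<omega> $ i \<and> y < \<omega> $ j} \<le> c * t" by simp
    qed
  qed (use continuous_on_cdf_component[OF df assms(4)] \<mu>.prob_space_axioms in auto)
qed

end
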